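(* Let $\Omega\subset\mathbb{R}^N$ be a bounded $C^1$ domain satisfying the interior sphere condition. Assume that $F$ satisfies the homogeneity condition, the ellipticity condition and the Hölder condition in $x$ stated in the context, that $b:\overline{\Omega}\to\mathbb{R}^N$ and $c:\overline{\Omega}\to\mathbb{R}$ are bounded and continuous, that $f:\partial\Omega\times\mathbb{R}\to\mathbb{R}$ satisfies $f(x,0)\ge0$ for all $x\in\partial\Omega$, and that $r\mapsto f(x,r)$ is non-decreasing on $\mathbb{R}$ for all $x\in\partial\Omega$. Suppose $c\le 0$ and $c\not\equiv0$. If $u\in USC(\overline{\Omega})$ is a viscosity subsolution of $$\begin{cases} F(x,Du,D^2u)+b(x)\cdot Du|Du|^\alpha+c(x)|u|^\alpha u= 0 & \text{in } \Omega,\\ f(x,u)+\langle Du,\overrightarrow{n}(x)\rangle=0 & \text{on }\partial\Omega,\end{cases}$$ then $u\le0$ in $\overline{\Omega}$. The same conclusion holds also if $c\equiv0$ (all the other assumptions being kept) in the following two cases: (i) $\Omega$ is a $C^2$ domain and there exists $\overline{x}\in\partial\Omega$ such that $\langle b(\overline{x}),\overrightarrow{n}(\overline{x})\rangle>0$, $f(\overline{x},r)>0$ for any $r>0$, and $S\le0$, where $S$ is the symmetric operator corresponding to the second fundamental form of $\partial\Omega$ at $\overline{x}$ oriented with the exterior normal to $\Omega$; (ii) there exists $\overline{x}\in\partial\Omega$ such that $f(\overline{x},r)>0$ for any $r>0$, and $u$ is a strong subsolution.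
   Context: Fix $\alpha>-1$. $S(N)$ is the space of symmetric $N\times N$ real matrices with the usual ordering and norm $\|X\|=\sup\{|X\xi|:|\xi|\le 1\}$; $USC(\overline\Omega)$ denotes the upper semicontinuous functions on $\overline\Omega$; $\overrightarrow{n}(x)$ is the exterior unit normal to $\Omega$ at $x\in\partial\Omega$. $F:\overline{\Omega}\times(\mathbb{R}^N\setminus\{0\})\times S(N)\to\mathbb{R}$. Interior sphere condition: for each $x\in\partial\Omega$ there exist $R>0$ and $y\in\Omega$ with $|x-y|=R$ and $B(y,R)\subset\Omega$. Homogeneity: $F(x,tp,\mu X)=|t|^\alpha\mu F(x,p,X)$ for all $t\in\mathbb{R}\setminus\{0\}$, $\mu\ge0$, $x\in\overline\Omega$, $p\ne0$, $X\in S(N)$. Ellipticity: there exist $a,A>0$ such that for all $x\in\overline{\Omega}$, $p\neq0$, $M,N'\in S(N)$ with $N'\ge0$: $a|p|^\alpha\,\mathrm{tr}N'\le F(x,p,M+N')-F(x,p,M)\le A|p|^\alpha\,\mathrm{tr}N'$. Hölder condition in $x$: there exist $C_1>0$, $\theta\in(\frac12,1]$ such that $|F(x,p,X)-F(y,p,X)|\le C_1|x-y|^\theta|p|^\alpha\|X\|$ for all $x,y\in\overline{\Omega}$, $p\ne0$, $X\in S(N)$. Viscosity subsolutions. Put $G(x,r,p,X)=F(x,p,X)+b(x)\cdot p|p|^\alpha+c(x)|r|^\alpha r$ for $p\ne0$, and $B(x,r,p)=f(x,r)+\langle p,\overrightarrow{n}(x)\rangle$. A function $u\in USC(\overline\Omega)$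 is a viscosity subsolution of the boundary value problem if: (i) for every $x_0\in\Omega$ and $\varphi\in C^2(\overline\Omega)$ such that $u-\varphi$ has a local maximum at $x_0$ and $D\varphi(x_0)\ne0$, $G(x_0,u(x_0),D\varphi(x_0),D^2\varphi(x_0))\ge 0$; and if $u\equiv k$ is constant in a neighborhood of $x_0$, then $c(x_0)|k|^\alpha k\ge 0$; (ii) for every $x_0\in\partial\Omega$ and $\varphi\in C^2(\overline\Omega)$ such that $u-\varphi$ has a local maximum in $\overline\Omega$ at $x_0$ and $D\varphi(x_0)\neq0$, $\min\{-G(x_0,u(x_0),D\varphi(x_0),D^2\varphi(x_0)),\,B(x_0,u(x_0),D\varphi(x_0))\}\le0$; and if $u\equiv k$ in a neighborhood of $x_0$ in $\overline\Omega$, then $\min\{-c(x_0)|k|^\alpha k,B(x_0,k,0)\}\le0$. A strong (viscosity) subsolution is a viscosity subsolution that moreover satisfies $B(x,u,Du)\le0$ in the viscosity sense at all $x\in\partial\Omega$, i.e. in (ii) the conclusions are replaced by $B(x_0,u(x_0),D\varphi(x_0))\le0$ and $B(x_0,k,0)\le0$ respectively. Sign convention for $S$: near $\overline x$, $\partial\Omega$ consists of the points $\overline{x}+\xi+\left(\tfrac12\langle S\xi,\xi\rangle+o(|\xi|^2)\right)\overrightarrow{n}(\overline x)$ with $\xi$ tangent to $\partial\Omega$ at $\overline x$; in particular $C^2$ convex sets satisfy $S\le0$ at every boundary point. *)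

theory Defs
  imports "HOL-Analysis.Analysis"
begin

section \<open>Domains of class C1 and C2\<close>

text \<open>
  A domain is of class Ck if near every boundary point it is the sublevel set
  \<open>{g < 0}\<close> of a Ck function \<open>g\<close> whose gradient does not vanish (by the implicit function
  theorem, this says that the domain lies locally on one side of the graph of a Ck function).
  In the following predicates \<open>Dg\<close> is the gradient and \<open>Hg\<close> the Hessian of \<open>g\<close>.
\<close>

definition C1_local_defining ::
  "(real^'n) set \<Rightarrow> (real^'n) set \<Rightarrow> (real^'n \<Rightarrow> real) \<Rightarrow> (real^'n \<Rightarrow> real^'n) \<Rightarrow> bool" where
  "C1_local_defining \<Omega> U g Dg \<longleftrightarrow>
     open U \<and> (\<forall>y\<in>U. GDERIV g y :> Dg y) \<and> continuous_on U Dg \<and>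
     (\<forall>y\<in>U. Dg y \<noteq> 0) \<and> \<Omega> \<inter> U = {y\<in>U. g y < 0}"

definition C2_local_defining ::
  "(real^'n) set \<Rightarrow> (real^'n) set \<Rightarrow> (real^'n \<Rightarrow> real) \<Rightarrow> (real^'n \<Rightarrow> real^'n) \<Rightarrow>
   (real^'n \<Rightarrow> real^'n^'n) \<Rightarrow> bool" where
  "C2_local_defining \<Omega> U g Dg Hg \<longleftrightarrow>
     C1_local_defining \<Omega> U g Dg \<and>
     (\<forall>y\<in>U. (Dg has_derivative (\<lambda>h. Hg y *v h)) (at y)) \<and> continuous_on U Hg"

definition C1_domain :: "(real^'n) set \<Rightarrow> bool" where
  "C1_domain \<Omega> \<longleftrightarrow> open \<Omega> \<and> connected \<Omega> \<and> \<Omega> \<noteq> {} \<and>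
     (\<forall>x\<in>frontier \<Omega>. \<exists>U g Dg. x \<in> U \<and> C1_local_defining \<Omega> U g Dg)"

definition C2_domain :: "(real^'n) set \<Rightarrow> bool" where
  "C2_domain \<Omega> \<longleftrightarrow> open \<Omega> \<and> connected \<Omega> \<and> \<Omega> \<noteq> {} \<and>
     (\<forall>x\<in>frontier \<Omega>. \<exists>U g Dg Hg. x \<in> U \<and> C2_local_defining \<Omega> U g Dg Hg)"

definition interior_sphere_condition :: "(real^'n) set \<Rightarrow> bool" where
  "interior_sphere_condition \<Omega> \<longleftrightarrow>
     (\<forall>x\<in>frontier \<Omega>. \<exists>R>0. \<exists>y\<in>\<Omega>. dist x y = R \<and> ball y R \<subseteq> \<Omega>)"

text \<open>The exterior unit normal at a boundary point; it does not depend on the chosen defining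
  function, see \<open>exterior_normal_eq\<close> below.\<close>

definition exterior_normal :: "(real^'n) set \<Rightarrow> real^'n \<Rightarrow> real^'n" where
  "exterior_normal \<Omega> x =
     (THE n. \<exists>U g Dg. x \<in> U \<and> C1_local_defining \<Omega> U g Dg \<and> n = Dg x /\<^sub>R norm (Dg x))"

lemma C1_local_defining_zero:
  fixes x :: "real^'n"
  assumes "C1_local_defining \<Omega> U g Dg" "open \<Omega>" "x \<in> frontier \<Omega>" "x \<in> U"
  shows "g x = 0"
proof -
  have U: "open U" and der: "GDERIV g x :> Dg x" and eq: "\<Omega> \<inter> U = {y\<in>U. g y < 0}"
    using assms by (auto simp: C1_local_defining_def)
  have "x \<notin> \<Omega>" using assms(2,3) by (simp add: frontier_def interior_open)
  hence "g x \<ge> 0" using eq assms(4) by force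
  moreover have "\<not> g x > 0"
  proof
    assume pos: "g x > 0"
    have "isCont g x" using der by (simp add: gderiv_def has_derivative_continuous)
    hence "\<forall>\<^sub>F y in at x. g y > 0"
      using pos by (simp add: isCont_def order_tendstoD(1))
    hence "\<forall>\<^sub>F y in nhds x. g y > 0"
      using pos by (simp add: eventually_nhds_conv_at)
    then obtain V where V: "open V" "x \<in> V" "\<forall>y\<in>V. g y > 0"
      unfolding eventually_nhds by blast
    have "x \<in> closure \<Omega>" using assms(3) by (simp add: frontier_def)
    then obtain y where "y \<in> \<Omega>" "y \<in> U \<inter> V"
      using open_Int[OF U V(1)] V(2) assms(4) by (metis IntI closure_iff_nhds_not_empty disjoint_iff order_refl)
    hence "g y < 0" "g y > 0" using eq V(3) by auto
    thus False by simp
  qed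
  ultimately show ?thesis by simp
qed

lemma exterior_normal_unique_aux:
  fixes x :: "real^'n"
  assumes g: "C1_local_defining \<Omega> U g Dg" "x \<in> U" "g x = 0"
    and h: "C1_local_defining \<Omega> V h Dh" "x \<in> V" "h x = 0"
  shows "Dg x /\<^sub>R norm (Dg x) = Dh x /\<^sub>R norm (Dh x)"
proof (rule ccontr)
  define n m where "n = Dg x /\<^sub>R norm (Dg x)" and "m = Dh x /\<^sub>R norm (Dh x)"
  assume "Dg x /\<^sub>R norm (Dg x) \<noteq> Dh x /\<^sub>R norm (Dh x)"
  hence nm: "n \<noteq> m" by (simp add: n_def m_def)
  have D0: "Dg x \<noteq> 0" "Dh x \<noteq> 0" using g h by (auto simp: C1_local_defining_def)
  have n1: "n \<bullet> n = 1" and m1: "m \<bullet> m = 1"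
    using D0 by (simp_all add: n_def m_def dot_square_norm power2_eq_square)
  have "(n - m) \<bullet> (n - m) > 0" using nm by simp
  hence lt: "n \<bullet> m < 1" using n1 m1 by (simp add: inner_diff inner_commute)
  define v where "v = n - m"
  have v: "v \<bullet> n > 0" "v \<bullet> m < 0"
    using lt n1 m1 by (simp_all add: v_def inner_diff inner_commute)
  have "Dg x = norm (Dg x) *\<^sub>R n" "Dh x = norm (Dh x) *\<^sub>R m"
    using D0 by (simp_all add: n_def m_def)
  hence vD: "v \<bullet> Dg x > 0" "v \<bullet> Dh x < 0"
    using v D0 by (metis inner_scaleR_right mult_pos_pos zero_less_norm_iff)
      (metis \<open>Dh x = norm (Dh x) *\<^sub>R m\<close> v(2) D0(2) inner_scaleR_right mult_pos_neg zero_less_norm_iff)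
  have path: "((\<lambda>t. k (x + t *\<^sub>R v)) has_real_derivative v \<bullet> D) (at 0)"
    if "GDERIV k x :> D" for k :: "real^'n \<Rightarrow> real" and D
  proof -
    have "((\<lambda>t. x + t *\<^sub>R v) has_derivative (\<lambda>t. t *\<^sub>R v)) (at 0)"
      by (auto intro!: derivative_eq_intros)
    moreover have "(k has_derivative (\<lambda>h. h \<bullet> D)) (at (x + 0 *\<^sub>R v))"
      using that by (simp add: gderiv_def)
    ultimately have "((\<lambda>t. k (x + t *\<^sub>R v)) has_derivative (\<lambda>t. (t *\<^sub>R v) \<bullet> D)) (at 0)"
      by (rule has_derivative_compose)
    thus ?thesis by (simp add: has_field_derivative_def mult_commute_abs)
  qed
  obtain d1 where d1: "d1 > 0" "\<And>t. 0 < t \<Longrightarrow> t < d1 \<Longrightarrow> g x < g (x + t *\<^sub>R v)"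
    using DERIV_pos_inc_right[OF path[of g "Dg x"] vD(1)] g
    by (auto simp: C1_local_defining_def)
  obtain d2 where d2: "d2 > 0" "\<And>t. 0 < t \<Longrightarrow> t < d2 \<Longrightarrow> h x > h (x + t *\<^sub>R v)"
    using DERIV_neg_dec_right[OF path[of h "Dh x"] vD(2)] h
    by (auto simp: C1_local_defining_def)
  have "open (U \<inter> V)" "x \<in> U \<inter> V" using g h by (auto simp: C1_local_defining_def)
  then obtain e where e: "e > 0" "ball x e \<subseteq> U \<inter> V" using open_contains_ball by blast
  have v0: "norm v > 0" using nm by (simp add: v_def)
  have "0 < min (min d1 d2) (e / norm v)" using d1(1) d2(1) e(1) v0 by simp
  then obtain t where "0 < t" "t < min (min d1 d2) (e / norm v)" using dense by blast
  hence t: "0 < t" "t < d1" "t < d2" "t < e / norm v" by simp_all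
  hence "t * norm v < e" using v0 by (simp add: field_simps)
  hence "x + t *\<^sub>R v \<in> ball x e" using t by (simp add: dist_norm)
  hence "x + t *\<^sub>R v \<in> U" "x + t *\<^sub>R v \<in> V" using e by auto
  moreover have "g (x + t *\<^sub>R v) > 0" "h (x + t *\<^sub>R v) < 0"
    using d1 d2 t g(3) h(3) by force+
  ultimately show False
    using g(1) h(1) unfolding C1_local_defining_def by (smt (verit) Int_iff mem_Collect_eq)
qed

lemma exterior_normal_eq:
  fixes x :: "real^'n"
  assumes "open \<Omega>" "x \<in> frontier \<Omega>" "x \<in> U" "C1_local_defining \<Omega> U g Dg"
  shows "exterior_normal \<Omega> x = Dg x /\<^sub>R norm (Dg x)"
  unfolding exterior_normal_def
  using assms exterior_normal_unique_aux C1_local_defining_zero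
  by (intro the_equality) blast+

section \<open>Symmetric matrices and the second fundamental form\<close>

definition loewner_le :: "real^'n^'n \<Rightarrow> real^'n^'n \<Rightarrow> bool" where
  "loewner_le X Y \<longleftrightarrow> (\<forall>\<xi>. \<xi> \<bullet> (X *v \<xi>) \<le> \<xi> \<bullet> (Y *v \<xi>))"

text \<open>
  The symmetric operator of the second fundamental form, oriented by the exterior normal, acts on
  the tangent space \<open>{\<xi>. \<xi> \<bullet> n = 0}\<close>; it is represented by the symmetric matrix
  that extends it by 0 in the normal direction, so that it is negative semidefinite on the tangent
  space iff the matrix is. With this sign convention it is \<open>\<le> 0\<close> for convex domains.
\<close>

definition second_fundamental_form :: "(real^'n) set \<Rightarrow> real^'n \<Rightarrow> real^'n^'n \<Rightarrow> bool" where
  "second_fundamental_form \<Omega> x S \<longleftrightarrow>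
     (let n = exterior_normal \<Omega> x; T = {\<xi>. \<xi> \<bullet> n = 0} in
      transpose S = S \<and> S *v n = 0 \<and>
      (\<exists>U \<rho>. open U \<and> x \<in> U \<and> ((\<lambda>\<xi>. \<rho> \<xi> / (norm \<xi>)\<^sup>2) \<longlongrightarrow> 0) (at 0 within T) \<and>
         frontier \<Omega> \<inter> U = (\<lambda>\<xi>. x + \<xi> + ((\<xi> \<bullet> (S *v \<xi>)) / 2 + \<rho> \<xi>) *\<^sub>R n) ` T \<inter> U))"

section \<open>Structure conditions on the operator\<close>

text \<open>\<open>F\<close> is only ever evaluated at \<open>x \<in> closure \<Omega>\<close>, \<open>p \<noteq> 0\<close> and
  symmetric \<open>X\<close>.\<close>

definition homogeneity_condition ::
  "(real^'n) set \<Rightarrow> real \<Rightarrow> (real^'n \<Rightarrow> real^'n \<Rightarrow> real^'n^'n \<Rightarrow> real) \<Rightarrow> bool" where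
  "homogeneity_condition \<Omega> \<alpha> F \<longleftrightarrow>
     (\<forall>x\<in>closure \<Omega>. \<forall>p X t \<mu>. p \<noteq> 0 \<and> transpose X = X \<and> t \<noteq> 0 \<and> \<mu> \<ge> 0 \<longrightarrow>
        F x (t *\<^sub>R p) (\<mu> *\<^sub>R X) = \<bar>t\<bar> powr \<alpha> * \<mu> * F x p X)"

definition ellipticity_condition ::
  "(real^'n) set \<Rightarrow> real \<Rightarrow> (real^'n \<Rightarrow> real^'n \<Rightarrow> real^'n^'n \<Rightarrow> real) \<Rightarrow> bool" where
  "ellipticity_condition \<Omega> \<alpha> F \<longleftrightarrow>
     (\<exists>a>0. \<exists>A>0. \<forall>x\<in>closure \<Omega>. \<forall>p M N.
        p \<noteq> 0 \<and> transpose M = M \<and> transpose N = N \<and> loewner_le 0 N \<longrightarrow>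
        a * norm p powr \<alpha> * trace N \<le> F x p (M + N) - F x p M \<and>
        F x p (M + N) - F x p M \<le> A * norm p powr \<alpha> * trace N)"

definition holder_condition ::
  "(real^'n) set \<Rightarrow> real \<Rightarrow> (real^'n \<Rightarrow> real^'n \<Rightarrow> real^'n^'n \<Rightarrow> real) \<Rightarrow> bool" where
  "holder_condition \<Omega> \<alpha> F \<longleftrightarrow>
     (\<exists>C1>0. \<exists>\<theta>\<in>{1/2<..1}. \<forall>x\<in>closure \<Omega>. \<forall>y\<in>closure \<Omega>. \<forall>p X.
        p \<noteq> 0 \<and> transpose X = X \<longrightarrow>
        \<bar>F x p X - F y p X\<bar> \<le> C1 * dist x y powr \<theta> * norm p powr \<alpha> * onorm ((*v) X))"

section \<open>Viscosity subsolutions\<close>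

definition usc_on :: "'a::topological_space set \<Rightarrow> ('a \<Rightarrow> real) \<Rightarrow> bool" where
  "usc_on K u \<longleftrightarrow> (\<forall>x\<in>K. \<forall>a>u x. \<forall>\<^sub>F y in at x within K. u y < a)"

text \<open>\<open>\<phi>\<close> is C2 up to the boundary: it is C2 in \<open>\<Omega>\<close>, and \<open>\<phi>\<close>, its gradient
  \<open>D\<phi>\<close> and its Hessian \<open>H\<phi>\<close> extend continuously to the closure (so the values of
  \<open>D\<phi>\<close> and \<open>H\<phi>\<close> on the boundary are determined by \<open>\<phi>\<close>).\<close>

definition C2_closure ::
  "(real^'n) set \<Rightarrow> (real^'n \<Rightarrow> real) \<Rightarrow> (real^'n \<Rightarrow> real^'n) \<Rightarrow> (real^'n \<Rightarrow> real^'n^'n) \<Rightarrow> bool" where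
  "C2_closure \<Omega> \<phi> D\<phi> H\<phi> \<longleftrightarrow>
     continuous_on (closure \<Omega>) \<phi> \<and> continuous_on (closure \<Omega>) D\<phi> \<and>
     continuous_on (closure \<Omega>) H\<phi> \<and>
     (\<forall>x\<in>\<Omega>. GDERIV \<phi> x :> D\<phi> x) \<and>
     (\<forall>x\<in>\<Omega>. (D\<phi> has_derivative (\<lambda>h. H\<phi> x *v h)) (at x))"

definition local_max_at :: "'a::topological_space set \<Rightarrow> ('a \<Rightarrow> real) \<Rightarrow> 'a \<Rightarrow> bool" where
  "local_max_at K w x0 \<longleftrightarrow> x0 \<in> K \<and> (\<exists>V. open V \<and> x0 \<in> V \<and> (\<forall>x\<in>V \<inter> K. w x \<le> w x0))"

definition locally_const_at :: "'a::topological_space set \<Rightarrow> ('a \<Rightarrow> real) \<Rightarrow> 'a \<Rightarrow> real \<Rightarrow> bool" where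
  "locally_const_at K u x0 k \<longleftrightarrow> x0 \<in> K \<and> (\<exists>V. open V \<and> x0 \<in> V \<and> (\<forall>x\<in>V \<inter> K. u x = k))"

text \<open>At \<open>r = 0\<close> the term \<open>\<bar>r\<bar> powr \<alpha> * r\<close> is 0 also for negative \<open>\<alpha>\<close>.\<close>

definition G_op ::
  "real \<Rightarrow> (real^'n \<Rightarrow> real^'n \<Rightarrow> real^'n^'n \<Rightarrow> real) \<Rightarrow> (real^'n \<Rightarrow> real^'n) \<Rightarrow> (real^'n \<Rightarrow> real) \<Rightarrow>
   real^'n \<Rightarrow> real \<Rightarrow> real^'n \<Rightarrow> real^'n^'n \<Rightarrow> real" where
  "G_op \<alpha> F b c x r p X =
     F x p X + (b x \<bullet> p) * norm p powr \<alpha> + c x * (\<bar>r\<bar> powr \<alpha> * r)"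

definition B_op ::
  "(real^'n) set \<Rightarrow> (real^'n \<Rightarrow> real \<Rightarrow> real) \<Rightarrow> real^'n \<Rightarrow> real \<Rightarrow> real^'n \<Rightarrow> real" where
  "B_op \<Omega> f x r p = f x r + p \<bullet> exterior_normal \<Omega> x"

definition viscosity_subsolution ::
  "(real^'n) set \<Rightarrow> real \<Rightarrow> (real^'n \<Rightarrow> real^'n \<Rightarrow> real^'n^'n \<Rightarrow> real) \<Rightarrow> (real^'n \<Rightarrow> real^'n) \<Rightarrow>
   (real^'n \<Rightarrow> real) \<Rightarrow> (real^'n \<Rightarrow> real \<Rightarrow> real) \<Rightarrow> (real^'n \<Rightarrow> real) \<Rightarrow> bool" where
  "viscosity_subsolution \<Omega> \<alpha> F b c f u \<longleftrightarrow>
     usc_on (closure \<Omega>) u \<and>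
     (\<forall>x0\<in>\<Omega>.
        (\<forall>\<phi> D\<phi> H\<phi>. C2_closure \<Omega> \<phi> D\<phi> H\<phi> \<and> local_max_at \<Omega> (\<lambda>x. u x - \<phi> x) x0 \<and> D\<phi> x0 \<noteq> 0 \<longrightarrow>
           G_op \<alpha> F b c x0 (u x0) (D\<phi> x0) (H\<phi> x0) \<ge> 0) \<and>
        (\<forall>k. locally_const_at \<Omega> u x0 k \<longrightarrow> c x0 * (\<bar>k\<bar> powr \<alpha> * k) \<ge> 0)) \<and>
     (\<forall>x0\<in>frontier \<Omega>.
        (\<forall>\<phi> D\<phi> H\<phi>. C2_closure \<Omega> \<phi> D\<phi> H\<phi> \<and> local_max_at (closure \<Omega>) (\<lambda>x. u x - \<phi> x) x0 \<and>
             D\<phi> x0 \<noteq> 0 \<longrightarrow>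
           min (- G_op \<alpha> F b c x0 (u x0) (D\<phi> x0) (H\<phi> x0)) (B_op \<Omega> f x0 (u x0) (D\<phi> x0)) \<le> 0) \<and>
        (\<forall>k. locally_const_at (closure \<Omega>) u x0 k \<longrightarrow>
           min (- (c x0 * (\<bar>k\<bar> powr \<alpha> * k))) (B_op \<Omega> f x0 k 0) \<le> 0))"

definition strong_subsolution ::
  "(real^'n) set \<Rightarrow> real \<Rightarrow> (real^'n \<Rightarrow> real^'n \<Rightarrow> real^'n^'n \<Rightarrow> real) \<Rightarrow> (real^'n \<Rightarrow> real^'n) \<Rightarrow>
   (real^'n \<Rightarrow> real) \<Rightarrow> (real^'n \<Rightarrow> real \<Rightarrow> real) \<Rightarrow> (real^'n \<Rightarrow> real) \<Rightarrow> bool" where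
  "strong_subsolution \<Omega> \<alpha> F b c f u \<longleftrightarrow>
     viscosity_subsolution \<Omega> \<alpha> F b c f u \<and>
     (\<forall>x0\<in>frontier \<Omega>.
        (\<forall>\<phi> D\<phi> H\<phi>. C2_closure \<Omega> \<phi> D\<phi> H\<phi> \<and> local_max_at (closure \<Omega>) (\<lambda>x. u x - \<phi> x) x0 \<and>
             D\<phi> x0 \<noteq> 0 \<longrightarrow> B_op \<Omega> f x0 (u x0) (D\<phi> x0) \<le> 0) \<and>
        (\<forall>k. locally_const_at (closure \<Omega>) u x0 k \<longrightarrow> B_op \<Omega> f x0 k 0 \<le> 0))"

end

theory Submission
  imports Defs
begin

text \<open>
  The theorem is a strong maximum principle combined with the Hopf boundary lemma. Suppose that the
  maximum \<open>m\<close> of \<open>u\<close> over the closure (attained by upper semicontinuity) is positive.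

  The only test functions needed for the maximum principle are the classical radial barriers
  \<open>w x = m - \<delta> * (exp (- k * |x - y|^2) - exp (- k * R^2))\<close>. For \<open>k\<close> large, ellipticity and
  homogeneity make \<open>w\<close> a strict supersolution in the annulus \<open>R / 2 \<le> |x - y| \<le> R\<close>
  (\<open>barrier_strict_supersolution\<close>); the zero order term has the good sign because \<open>c \<le> 0\<close> and
  \<open>u > 0\<close> at the points in question. If \<open>u < m\<close> in a ball \<open>ball y R\<close> contained in \<open>\<Omega>\<close> and
  \<open>u = m\<close> at a point \<open>x0\<close> of its sphere, comparison in the annulus shows that \<open>w\<close> touches
  \<open>u\<close> from above at \<open>x0\<close> relative to the whole closure of \<open>\<Omega>\<close>
  (\<open>hopf_test_function\<close>).

  If \<open>x0\<close> lies in \<open>\<Omega>\<close>, this contradicts the equation. If \<open>x0\<close> is a boundary point, the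
  boundary condition forces \<open>f x0 m + \<langle>Dw x0, n\<rangle> \<le> 0\<close>, where \<open>f x0 m \<ge> 0\<close> and
  \<open>\<langle>Dw x0, n\<rangle> > 0\<close>, again a contradiction. So the maximum is attained inside, and connectedness
  yields \<open>u = m\<close> on the closure (\<open>subsolution_positive_max_constant\<close>).

  A positive constant is then excluded as follows. If \<open>c\<close> does not vanish identically, the condition
  on locally constant subsolutions gives \<open>c \<ge> 0\<close> in \<open>\<Omega>\<close>, hence \<open>c = 0\<close> by continuity. For a
  strong subsolution the boundary condition at the distinguished point reads \<open>f xb m \<le> 0\<close>. In the
  remaining case one tests at the distinguished point with
  \<open>\<phi> x = t * (e * |x - xb|^2 - \<langle>x - xb, n\<rangle>)\<close>: since the second fundamental form is \<open>\<le> 0\<close>, the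
  domain lies below the paraboloid \<open>\<langle>x - xb, n\<rangle> = e * |x - xb|^2\<close> (\<open>closure_below_paraboloid\<close>),
  so \<open>\<phi>\<close> has a local minimum there, while for small \<open>e\<close> and \<open>t\<close> the drift \<open>\<langle>b, n\<rangle> > 0\<close>
  and \<open>f xb m > 0\<close> violate both alternatives of the boundary condition.
\<close>

section \<open>Upper semicontinuous functions on compact sets\<close>

lemma usc_on_subset: "usc_on K u \<Longrightarrow> L \<subseteq> K \<Longrightarrow> usc_on L u"
  unfolding usc_on_def by (meson filter_leD at_le subsetD)

lemma usc_on_diff_continuous:
  fixes u w :: "'a::topological_space \<Rightarrow> real"
  assumes u: "usc_on K u" and w: "continuous_on K w"
  shows "usc_on K (\<lambda>x. u x - w x)"
  unfolding usc_on_def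
proof (intro ballI allI impI)
  fix x a assume x: "x \<in> K" and a: "u x - w x < a"
  define e where "e = (a - (u x - w x)) / 2"
  have e: "e > 0" using a by (simp add: e_def)
  have "\<forall>\<^sub>F y in at x within K. u y < u x + e"
    using u x e unfolding usc_on_def by simp
  moreover have "\<forall>\<^sub>F y in at x within K. w x - e < w y"
    using w x e by (intro order_tendstoD(1)[of w "w x"]) (auto simp: continuous_on_def)
  ultimately show "\<forall>\<^sub>F y in at x within K. u y - w y < a"
    by eventually_elim (simp add: e_def field_simps)
qed

lemma usc_attains_max:
  fixes u :: "'a::topological_space \<Rightarrow> real"
  assumes K: "compact K" "K \<noteq> {}" and u: "usc_on K u"
  shows "\<exists>x\<in>K. \<forall>y\<in>K. u y \<le> u x"
proof (rule ccontr)
  assume "\<not> ?thesis"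
  then have "\<forall>x\<in>K. \<exists>y\<in>K. u x < u y" by (meson not_le)
  \<comment> \<open>Each point has a neighbourhood on which \<open>u\<close> stays below the value of \<open>u\<close> at another point
    of \<open>K\<close>; a finite subcover bounds \<open>u\<close> strictly by one of its own values.\<close>
  then obtain s where s: "\<And>x. x \<in> K \<Longrightarrow> s x \<in> K \<and> u x < u (s x)" by metis
  have "\<exists>V. open V \<and> x \<in> V \<and> (\<forall>y\<in>V \<inter> K. u y < u (s x))" if x: "x \<in> K" for x
  proof -
    have "\<forall>\<^sub>F y in at x within K. u y < u (s x)"
      using u s[OF x] x unfolding usc_on_def by blast
    then obtain V where "open V" "x \<in> V" "\<forall>y\<in>V. y \<noteq> x \<longrightarrow> y \<in> K \<longrightarrow> u y < u (s x)"
      unfolding eventually_at_topological by blast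
    then show ?thesis using s[OF x] by (intro exI[of _ V]) auto
  qed
  then obtain V where V: "\<And>x. x \<in> K \<Longrightarrow> open (V x) \<and> x \<in> V x \<and> (\<forall>y\<in>V x \<inter> K. u y < u (s x))"
    by metis
  have "\<And>x. x \<in> K \<Longrightarrow> open (V x)" "K \<subseteq> (\<Union>x\<in>K. V x)" using V by blast+
  then obtain C where C: "C \<subseteq> K" "finite C" "K \<subseteq> (\<Union>x\<in>C. V x)"
    using compactE_image[OF K(1), of K V] by metis
  have "C \<noteq> {}" using C K by auto
  then obtain z where z: "z \<in> C" "\<forall>x\<in>C. u (s x) \<le> u (s z)"
  proof -
    have "Max ((\<lambda>x. u (s x)) ` C) \<in> (\<lambda>x. u (s x)) ` C"
      using C(2) \<open>C \<noteq> {}\<close> by (intro Max_in) auto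
    moreover have "\<forall>x\<in>C. u (s x) \<le> Max ((\<lambda>x. u (s x)) ` C)" using C(2) by simp
    ultimately show ?thesis using that by auto
  qed
  have "s z \<in> K" using z C s by blast
  then obtain x where "x \<in> C" "s z \<in> V x" using C by blast
  then have "u (s z) < u (s x)" using V C(1) \<open>s z \<in> K\<close> by blast
  with z(2) \<open>x \<in> C\<close> show False by (simp add: leD)
qed

lemma usc_uniform_bound:
  fixes u :: "'a::topological_space \<Rightarrow> real"
  assumes "compact K" "usc_on K u" "\<And>x. x \<in> K \<Longrightarrow> u x < m"
  shows "\<exists>\<eta>>0. \<forall>x\<in>K. u x \<le> m - \<eta>"
proof (cases "K = {}")
  case True
  then show ?thesis by (auto intro: exI[of _ 1])
next
  case False
  then obtain z where "z \<in> K" "\<forall>y\<in>K. u y \<le> u z" using usc_attains_max assms by blast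
  then show ?thesis using assms(3)[of z] by (intro exI[of _ "m - u z"]) auto
qed

section \<open>Rank-one matrices and the ellipticity bound\<close>

text \<open>The tensor square of \<open>z\<close>, that is, the symmetric matrix of \<open>h \<mapsto> \<langle>z, h\<rangle> z\<close>.\<close>

definition outer :: "real^'n \<Rightarrow> real^'n^'n" where
  "outer z = (\<chi> i j. z $ i * z $ j)"

lemma outer_mult_vec: "outer z *v h = (z \<bullet> h) *\<^sub>R z"
  by (simp add: outer_def matrix_vector_mult_def vec_eq_iff inner_vec_def sum_distrib_left
      mult_ac)

lemma transpose_outer: "transpose (outer z) = outer z"
  by (simp add: outer_def transpose_def mult.commute)

lemma trace_outer: "trace (outer z) = z \<bullet> z"
  by (simp add: outer_def trace_def inner_vec_def)

lemma trace_scaleR: "trace (r *\<^sub>R X) = r * trace (X :: real^'n^'n)"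
  by (simp add: trace_def sum_distrib_left)

lemma transpose_scaleR: "transpose (r *\<^sub>R X) = r *\<^sub>R transpose (X :: real^'n^'m)"
  by (simp add: transpose_def vec_eq_iff)

lemma transpose_diff: "transpose (X - Y) = transpose X - transpose (Y :: real^'n^'m)"
  by (simp add: transpose_def vec_eq_iff)

lemma loewner_outer: "r \<ge> 0 \<Longrightarrow> loewner_le 0 (r *\<^sub>R outer z)"
  by (simp add: loewner_le_def scaleR_matrix_vector_assoc[symmetric] outer_mult_vec inner_commute
      mult.assoc)

text \<open>
  The matrices \<open>s *\<^sub>R (mat 1 - N)\<close> include the Hessians of all test functions used below. The bound
  uses the upper ellipticity inequality from \<open>0\<close> to the identity, where \<open>F x p 0 = 0\<close> by
  homogeneity, and the lower one from \<open>mat 1 - N\<close> to the identity.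
\<close>

lemma elliptic_upper_bound:
  fixes F :: "real^'n \<Rightarrow> real^'n \<Rightarrow> real^'n^'n \<Rightarrow> real"
  assumes "homogeneity_condition \<Omega> \<alpha> F" and "ellipticity_condition \<Omega> \<alpha> F"
  obtains a A :: real where "a > 0" "A > 0"
    "\<And>x p s N. x \<in> closure \<Omega> \<Longrightarrow> p \<noteq> 0 \<Longrightarrow> s \<ge> 0 \<Longrightarrow> transpose N = N \<Longrightarrow> loewner_le 0 N \<Longrightarrow>
       F x p (s *\<^sub>R (mat 1 - N)) \<le> s * (norm p powr \<alpha> * (A * CARD('n) - a * trace N))"
proof -
  obtain a A where pos: "a > 0" "A > 0" and ell: "\<forall>x\<in>closure \<Omega>. \<forall>p M N.
        p \<noteq> 0 \<and> transpose M = M \<and> transpose N = N \<and> loewner_le 0 N \<longrightarrow>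
        a * norm p powr \<alpha> * trace N \<le> F x p (M + N) - F x p M \<and>
        F x p (M + N) - F x p M \<le> A * norm p powr \<alpha> * trace N"
    using assms(2) unfolding ellipticity_condition_def by blast
  have "F x p (s *\<^sub>R (mat 1 - N)) \<le> s * (norm p powr \<alpha> * (A * CARD('n) - a * trace N))"
    if x: "x \<in> closure \<Omega>" and p: "p \<noteq> 0" and s: "s \<ge> 0"
      and N: "transpose N = N" "loewner_le 0 N" for x p s N
  proof -
    have hom: "F x p (\<mu> *\<^sub>R X) = \<mu> * F x p X" if "transpose X = X" "\<mu> \<ge> 0" for X \<mu>
      using assms(1) x p that unfolding homogeneity_condition_def
      by (metis abs_one mult_1 powr_one_eq_one scaleR_one zero_neq_one)
    have sI: "transpose (mat 1 - N) = mat 1 - N" using N by (simp add: transpose_diff transpose_mat)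
    have "transpose (0::real^'n^'n) = 0" by (simp add: transpose_def vec_eq_iff)
    moreover have "loewner_le 0 (mat 1 :: real^'n^'n)" by (simp add: loewner_le_def)
    moreover have "trace (mat 1 :: real^'n^'n) = CARD('n)" by (simp add: trace_def mat_def)
    ultimately have "F x p (mat 1) - F x p 0 \<le> A * norm p powr \<alpha> * CARD('n)"
      using ell[rule_format, OF x, of p 0 "mat 1"] p by (simp add: transpose_mat)
    moreover have "F x p 0 = 0" using hom[of 0 0] \<open>transpose 0 = 0\<close> by simp
    moreover have "a * norm p powr \<alpha> * trace N \<le> F x p (mat 1) - F x p (mat 1 - N)"
      using ell[rule_format, OF x, of p "mat 1 - N" N] p N sI by simp
    ultimately have "F x p (mat 1 - N) \<le> norm p powr \<alpha> * (A * CARD('n) - a * trace N)"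
      by (simp add: algebra_simps)
    then show ?thesis using hom[OF sI s] s by (simp add: mult_left_mono)
  qed
  then show ?thesis using that pos by blast
qed

section \<open>Radial barriers and the Hopf test function\<close>

text \<open>
  The barrier equals \<open>m\<close> on the sphere of radius \<open>R\<close> about \<open>y\<close> and, for positive
  \<open>\<delta>\<close> and \<open>k\<close>, increases with the distance from \<open>y\<close>. It is smooth on the whole space, as it depends on \<open>|x - y|^2\<close> only.
\<close>

definition barrier :: "real \<Rightarrow> real \<Rightarrow> real \<Rightarrow> real \<Rightarrow> real^'n \<Rightarrow> real^'n \<Rightarrow> real" where
  "barrier m \<delta> k R y x = m - \<delta> * (exp (- k * ((x - y) \<bullet> (x - y))) - exp (- k * R\<^sup>2))"

text \<open>The scalar factor that the gradient and the Hessian of the barrier have in common.\<close>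

definition barrier_coeff :: "real \<Rightarrow> real \<Rightarrow> real^'n \<Rightarrow> real^'n \<Rightarrow> real" where
  "barrier_coeff \<delta> k y x = 2 * k * \<delta> * exp (- k * ((x - y) \<bullet> (x - y)))"

text \<open>The gradient of \<open>barrier m \<delta> k R y\<close>; it does not depend on \<open>m\<close> and \<open>R\<close>.\<close>

definition barrier_grad :: "real \<Rightarrow> real \<Rightarrow> real^'n \<Rightarrow> real^'n \<Rightarrow> real^'n" where
  "barrier_grad \<delta> k y x = barrier_coeff \<delta> k y x *\<^sub>R (x - y)"

text \<open>The Hessian of \<open>barrier m \<delta> k R y\<close>.\<close>

definition barrier_hess :: "real \<Rightarrow> real \<Rightarrow> real^'n \<Rightarrow> real^'n \<Rightarrow> real^'n^'n" where
  "barrier_hess \<delta> k y x = barrier_coeff \<delta> k y x *\<^sub>R (mat 1 - (2 * k) *\<^sub>R outer (x - y))"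

lemma C2_closure_barrier:
  "C2_closure \<Omega> (barrier m \<delta> k R y) (barrier_grad \<delta> k y) (barrier_hess \<delta> k y)"
proof -
  have sq: "((\<lambda>x. (x - y) \<bullet> (x - y)) has_derivative (\<lambda>h. 2 * ((x - y) \<bullet> h))) (at x)" for x
    by (rule has_derivative_eq_rhs, (rule derivative_intros)+) (simp add: inner_commute fun_eq_iff)
  have ex: "((\<lambda>x. exp (- k * ((x - y) \<bullet> (x - y)))) has_derivative
      (\<lambda>h. - 2 * k * exp (- k * ((x - y) \<bullet> (x - y))) * ((x - y) \<bullet> h))) (at x)" for x
    by (rule has_derivative_eq_rhs, rule has_derivative_exp, rule has_derivative_mult_right, rule sq)
      (simp add: fun_eq_iff)
  have 1: "GDERIV (barrier m \<delta> k R y) x :> barrier_grad \<delta> k y x" for x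
    unfolding gderiv_def barrier_def[abs_def] barrier_grad_def barrier_coeff_def
    by (rule has_derivative_eq_rhs, rule has_derivative_diff[OF has_derivative_const],
        rule has_derivative_mult_right, rule has_derivative_diff[OF ex has_derivative_const])
      (simp add: fun_eq_iff inner_commute)
  have 2: "(barrier_grad \<delta> k y has_derivative (\<lambda>h. barrier_hess \<delta> k y x *v h)) (at x)" for x
    unfolding barrier_grad_def[abs_def] barrier_hess_def barrier_coeff_def
    by (rule has_derivative_eq_rhs, rule has_derivative_scaleR, rule has_derivative_mult_right,
        rule ex, rule has_derivative_diff[OF has_derivative_ident has_derivative_const])
      (simp add: fun_eq_iff scaleR_matrix_vector_assoc[symmetric]
        matrix_vector_mult_diff_rdistrib outer_mult_vec scaleR_diff_right mult_ac)
  show ?thesis unfolding C2_closure_def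
  proof (intro conjI ballI 1 2)
    show "continuous_on (closure \<Omega>) (barrier m \<delta> k R y)"
      unfolding barrier_def[abs_def] by (intro continuous_intros)
    show "continuous_on (closure \<Omega>) (barrier_grad \<delta> k y)"
      unfolding barrier_grad_def[abs_def] barrier_coeff_def by (intro continuous_intros)
    show "continuous_on (closure \<Omega>) (barrier_hess \<delta> k y)"
      unfolding barrier_hess_def[abs_def] barrier_coeff_def outer_def
      by (intro continuous_intros)
  qed
qed

text \<open>
  The radial second derivative of the barrier is of order \<open>- k\<close> relative to its gradient and
  to its tangential second derivatives, so one \<open>k\<close> serves for all centres \<open>y\<close> and heights
  \<open>\<delta>\<close>.
\<close>

lemma barrier_strict_supersolution:
  fixes F :: "real^'n \<Rightarrow> real^'n \<Rightarrow> real^'n^'n \<Rightarrow> real"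
  assumes "homogeneity_condition \<Omega> \<alpha> F" and "ellipticity_condition \<Omega> \<alpha> F"
    and b: "bounded (b ` closure \<Omega>)" and c: "\<forall>x\<in>closure \<Omega>. c x \<le> 0" and R: "R > 0"
  obtains k where "k > 0"
    "\<And>\<delta> y x v. \<delta> > 0 \<Longrightarrow> x \<in> closure \<Omega> \<Longrightarrow> R / 2 \<le> dist x y \<Longrightarrow> dist x y \<le> R \<Longrightarrow> v \<ge> 0 \<Longrightarrow>
       G_op \<alpha> F b c x v (barrier_grad \<delta> k y x) (barrier_hess \<delta> k y x) < 0"
proof -
  obtain a A :: real where aA: "a > 0" "A > 0" and ell: "\<And>x p s N. x \<in> closure \<Omega> \<Longrightarrow> p \<noteq> 0 \<Longrightarrow> s \<ge> 0 \<Longrightarrow>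
       transpose N = N \<Longrightarrow> loewner_le 0 N \<Longrightarrow>
       F x p (s *\<^sub>R (mat 1 - N)) \<le> s * (norm p powr \<alpha> * (A * CARD('n) - a * trace N))"
    using elliptic_upper_bound[OF assms(1,2)] by metis
  obtain K where K: "K > 0" "\<And>x. x \<in> closure \<Omega> \<Longrightarrow> norm (b x) \<le> K"
    using b unfolding bounded_pos by blast
  \<comment> \<open>The term \<open>2 * k * a * |x - y|^2\<close> from the rank-one part of the Hessian is smallest on the
    inner sphere, where it exceeds the bound for the identity part and the drift by 1; see \<open>kR\<close>.\<close>
  define k where "k = 2 * (A * CARD('n) + K * R + 1) / (a * R\<^sup>2)"
  have "A * CARD('n) + K * R + 1 > 0" using aA K(1) R by (simp add: add_pos_pos)
  then have k: "k > 0" using aA R by (simp add: k_def)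
  have kR: "2 * k * a * (R / 2)\<^sup>2 = A * CARD('n) + K * R + 1"
    using aA(1) R by (simp add: k_def power_divide)
  have "G_op \<alpha> F b c x v (barrier_grad \<delta> k y x) (barrier_hess \<delta> k y x) < 0"
    if \<delta>: "\<delta> > 0" and x: "x \<in> closure \<Omega>" and r: "R / 2 \<le> dist x y" "dist x y \<le> R" and v: "v \<ge> 0"
    for \<delta> y x v
  proof -
    define z s p where "z = x - y" and "s = barrier_coeff \<delta> k y x" and "p = s *\<^sub>R z"
    have s: "s > 0" using \<delta> k by (simp add: s_def barrier_coeff_def)
    have rz: "R / 2 \<le> norm z" "norm z \<le> R" using r by (simp_all add: z_def dist_norm)
    then have p: "p \<noteq> 0" using s R by (auto simp: p_def)
    let ?N = "(2 * k) *\<^sub>R outer z"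
    have F: "F x p (s *\<^sub>R (mat 1 - ?N)) \<le> s * (norm p powr \<alpha> * (A * CARD('n) - a * trace ?N))"
      using k s by (intro ell x p) (simp_all add: transpose_scaleR transpose_outer loewner_outer)
    have "(R / 2)\<^sup>2 \<le> (norm z)\<^sup>2" using rz R by (intro power_mono) auto
    then have "2 * k * a * (R / 2)\<^sup>2 \<le> 2 * k * a * (norm z)\<^sup>2" using k aA by simp
    then have N: "a * trace ?N \<ge> A * CARD('n) + K * R + 1"
      using kR by (simp add: trace_scaleR trace_outer dot_square_norm mult_ac)
    have "b x \<bullet> p = s * (b x \<bullet> z)" by (simp add: p_def)
    also have "b x \<bullet> z \<le> norm (b x) * norm z" by (rule norm_cauchy_schwarz)
    also have "\<dots> \<le> K * R" using K x rz by (intro mult_mono) auto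
    finally have bp: "b x \<bullet> p \<le> s * (K * R)" using s by simp
    have n0: "norm p powr \<alpha> > 0" using p by simp
    have "F x p (s *\<^sub>R (mat 1 - ?N)) + (b x \<bullet> p) * norm p powr \<alpha>
        \<le> s * (norm p powr \<alpha> * (A * CARD('n) - a * trace ?N)) + s * (K * R) * norm p powr \<alpha>"
      using F bp n0 by (intro add_mono mult_right_mono) auto
    also have "\<dots> = s * norm p powr \<alpha> * (A * CARD('n) + K * R - a * trace ?N)"
      by (simp add: algebra_simps)
    also have "\<dots> < 0" using N s n0 by (intro mult_pos_neg) auto
    finally have "F x p (s *\<^sub>R (mat 1 - ?N)) + (b x \<bullet> p) * norm p powr \<alpha> < 0" .
    moreover have "c x * (\<bar>v\<bar> powr \<alpha> * v) \<le> 0" using c x v by (simp add: mult_nonpos_nonneg)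
    ultimately show ?thesis
      by (simp add: G_op_def barrier_grad_def barrier_hess_def s_def p_def z_def)
  qed
  with k show ?thesis using that by blast
qed

text \<open>
  The test function touches \<open>u\<close> from above at \<open>x0\<close> relative to the closure of \<open>\<Omega>\<close>, not just
  relative to the ball: outside the ball the barrier is at least \<open>m\<close>. Both cases
  \<open>x0 \<in> \<Omega>\<close> and \<open>x0 \<in> frontier \<Omega>\<close> are covered.
\<close>

lemma hopf_test_function:
  fixes F :: "real^'n \<Rightarrow> real^'n \<Rightarrow> real^'n^'n \<Rightarrow> real"
  assumes "homogeneity_condition \<Omega> \<alpha> F" and "ellipticity_condition \<Omega> \<alpha> F"
    and "bounded (b ` closure \<Omega>)" and "\<forall>x\<in>closure \<Omega>. c x \<le> 0"
    and sub: "viscosity_subsolution \<Omega> \<alpha> F b c f u" and "bounded \<Omega>"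
    and R: "R > 0" and B: "ball y R \<subseteq> \<Omega>" and m: "m > 0"
    and le: "\<forall>x\<in>closure \<Omega>. u x \<le> m" and lt: "\<forall>x\<in>ball y R. u x < m"
    and x0: "x0 \<in> closure \<Omega>" "dist x0 y = R" "u x0 = m"
  obtains \<phi> D\<phi> H\<phi> s where "C2_closure \<Omega> \<phi> D\<phi> H\<phi>" "local_max_at (closure \<Omega>) (\<lambda>x. u x - \<phi> x) x0"
    "s > 0" "D\<phi> x0 = s *\<^sub>R (x0 - y)" "G_op \<alpha> F b c x0 m (D\<phi> x0) (H\<phi> x0) < 0"
proof -
  obtain k where k: "k > 0" and strict: "\<And>\<delta> y x v. \<delta> > 0 \<Longrightarrow> x \<in> closure \<Omega> \<Longrightarrow> R / 2 \<le> dist x y \<Longrightarrow>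
       dist x y \<le> R \<Longrightarrow> v \<ge> 0 \<Longrightarrow>
       G_op \<alpha> F b c x v (barrier_grad \<delta> k y x) (barrier_hess \<delta> k y x) < 0"
    using barrier_strict_supersolution[OF assms(1-4) R] by metis
  have usc: "usc_on (closure \<Omega>) u" using sub unfolding viscosity_subsolution_def by blast
  have sph: "sphere y (R / 2) \<subseteq> ball y R" using R by auto
  have "sphere y (R / 2) \<subseteq> closure \<Omega>" using sph B closure_subset by blast
  then obtain \<eta> where \<eta>: "\<eta> > 0" "\<forall>x\<in>sphere y (R / 2). u x \<le> m - \<eta>"
    using usc_uniform_bound[of "sphere y (R / 2)" u m] usc_on_subset[OF usc] lt sph
    by (metis compact_sphere subsetD)
  \<comment> \<open>Below \<open>\<eta>\<close>, so that \<open>u < w\<close> on the inner sphere; below \<open>m\<close>, so that \<open>w > 0\<close>.\<close>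
  define \<delta> where "\<delta> = min \<eta> m / 2"
  have \<delta>: "0 < \<delta>" "\<delta> < \<eta>" "\<delta> < m" using \<eta> m by (auto simp: \<delta>_def)
  define w where "w = barrier m \<delta> k R y"
  define E where "E r = exp (- k * r\<^sup>2)" for r
  have w_eq: "w x = m - \<delta> * (E (dist x y) - E R)" for x
    by (simp add: w_def barrier_def E_def dist_norm dot_square_norm)
  have E_mono: "E r \<le> E r'" if "0 \<le> r'" "r' \<le> r" for r r'
    using that k by (simp add: E_def power_mono)
  have w_gt: "w x > m - \<delta>" for x
  proof -
    have "E (dist x y) \<le> E 0" by (rule E_mono) auto
    moreover have "E 0 = 1" "E R > 0" by (simp_all add: E_def)
    ultimately have "\<delta> * (E (dist x y) - E R) < \<delta> * 1" using \<delta>(1) by (intro mult_strict_left_mono) auto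
    then show ?thesis by (simp add: w_eq)
  qed
  have w_ge: "w x \<ge> m" if "dist x y \<ge> R" for x
    using E_mono[of R "dist x y"] that R \<delta>(1) by (simp add: w_eq mult_nonneg_nonpos)
  have C2: "C2_closure \<Omega> w (barrier_grad \<delta> k y) (barrier_hess \<delta> k y)"
    unfolding w_def by (rule C2_closure_barrier)
  have below: "u x \<le> w x" if x: "x \<in> closure \<Omega>" "dist x y \<ge> R / 2" for x
  proof (rule ccontr)
    assume "\<not> u x \<le> w x"
    then have "u x > w x" by simp
    \<comment> \<open>A positive maximum of \<open>u - w\<close> over \<open>L\<close> must lie in the open annulus, hence in \<open>\<Omega>\<close>,
      where \<open>w\<close> is an admissible test function but a strict supersolution.\<close>
    define L where "L = closure \<Omega> - ball y (R / 2)"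
    have "compact (closure \<Omega>)" using \<open>bounded \<Omega>\<close> by simp
    then have "compact L" unfolding L_def by (intro compact_diff) auto
    moreover have "usc_on L (\<lambda>x. u x - w x)"
      using usc C2 unfolding C2_closure_def L_def
      by (blast intro: usc_on_diff_continuous usc_on_subset continuous_on_subset)
    moreover have "x \<in> L" using x by (simp add: L_def dist_commute)
    ultimately obtain z where z: "z \<in> L" "\<forall>x\<in>L. u x - w x \<le> u z - w z"
      using usc_attains_max[of L "\<lambda>x. u x - w x"] by blast
    have pos: "u z > w z" using z(2) \<open>x \<in> L\<close> \<open>u x > w x\<close> by fastforce
    have zc: "z \<in> closure \<Omega>" "dist z y \<ge> R / 2" using z(1) by (auto simp: L_def dist_commute)
    have 1: "dist z y < R" using w_ge[of z] pos le zc(1) by force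
    have 2: "dist z y \<noteq> R / 2" using \<eta>(2) w_gt[of z] pos \<delta>(2) by (force simp: dist_commute)
    define V where "V = ball y R - cball y (R / 2)"
    have V: "open V" "z \<in> V" "V \<subseteq> L" "V \<subseteq> \<Omega>"
      using 1 2 zc B closure_subset[of \<Omega>] by (auto simp: V_def L_def dist_commute)
    have "local_max_at \<Omega> (\<lambda>x. u x - w x) z"
      unfolding local_max_at_def using V z(2) by blast
    moreover have "barrier_grad \<delta> k y z \<noteq> 0"
      using \<delta> k R zc(2) by (auto simp: barrier_grad_def barrier_coeff_def)
    ultimately have "G_op \<alpha> F b c z (u z) (barrier_grad \<delta> k y z) (barrier_hess \<delta> k y z) \<ge> 0"
      using sub C2 V unfolding viscosity_subsolution_def by blast
    moreover have "u z \<ge> 0" using pos w_gt[of z] \<delta>(3) by simp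
    ultimately show False using strict[of \<delta> z y "u z"] \<delta> zc 1 by simp
  qed
  show ?thesis
  proof
    show "C2_closure \<Omega> w (barrier_grad \<delta> k y) (barrier_hess \<delta> k y)" by (rule C2)
    have "w x0 = u x0" using x0 by (simp add: w_eq)
    moreover have "open (- cball y (R / 2))" "x0 \<in> - cball y (R / 2)"
      using x0 R by (auto simp: dist_commute)
    moreover have "u x \<le> w x" if "x \<in> - cball y (R / 2) \<inter> closure \<Omega>" for x
      using that by (intro below) (auto simp: dist_commute)
    ultimately show "local_max_at (closure \<Omega>) (\<lambda>x. u x - w x) x0"
      unfolding local_max_at_def using x0(1)
      by (intro conjI exI[of _ "- cball y (R / 2)"]) auto
    show "barrier_coeff \<delta> k y x0 > 0" using \<delta> k by (simp add: barrier_coeff_def)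
    show "barrier_grad \<delta> k y x0 = barrier_coeff \<delta> k y x0 *\<^sub>R (x0 - y)"
      by (simp add: barrier_grad_def)
    show "G_op \<alpha> F b c x0 m (barrier_grad \<delta> k y x0) (barrier_hess \<delta> k y x0) < 0"
      using strict \<delta> x0 R m by simp
  qed
qed

section \<open>The exterior normal and interior balls\<close>

lemma gderiv_along_line:
  fixes g :: "'a::real_inner \<Rightarrow> real"
  assumes "GDERIV g (x + t *\<^sub>R v) :> D"
  shows "((\<lambda>t. g (x + t *\<^sub>R v)) has_real_derivative v \<bullet> D) (at t)"
proof -
  have "((\<lambda>t. x + t *\<^sub>R v) has_derivative (\<lambda>t. t *\<^sub>R v)) (at t)"
    by (auto intro!: derivative_eq_intros)
  moreover have "(g has_derivative (\<lambda>h. h \<bullet> D)) (at (x + t *\<^sub>R v))"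
    using assms by (simp add: gderiv_def)
  ultimately have "((\<lambda>t. g (x + t *\<^sub>R v)) has_derivative (\<lambda>t. (t *\<^sub>R v) \<bullet> D)) (at t)"
    by (rule has_derivative_compose)
  then show ?thesis by (simp add: has_field_derivative_def mult_commute_abs)
qed

lemma norm_exterior_normal:
  fixes x :: "real^'n"
  assumes \<Omega>: "C1_domain \<Omega>" and x: "x \<in> frontier \<Omega>"
  shows "norm (exterior_normal \<Omega> x) = 1"
proof -
  obtain U g Dg where xU: "x \<in> U" and loc: "C1_local_defining \<Omega> U g Dg"
    using \<Omega> x unfolding C1_domain_def by blast
  then have "Dg x \<noteq> 0" by (auto simp: C1_local_defining_def)
  then show ?thesis
    using exterior_normal_eq[OF _ x xU loc] \<Omega> by (simp add: C1_domain_def)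
qed

text \<open>
  In fact \<open>x - y\<close> is a positive multiple of the normal, but only the sign of the inner product is
  needed, and it must be strict.
\<close>

lemma exterior_normal_of_interior_ball:
  fixes x y :: "real^'n"
  assumes \<Omega>: "C1_domain \<Omega>" and x: "x \<in> frontier \<Omega>"
    and R: "R > 0" "dist x y = R" and B: "ball y R \<subseteq> \<Omega>"
  shows "(x - y) \<bullet> exterior_normal \<Omega> x > 0"
proof -
  have op: "open \<Omega>" using \<Omega> by (simp add: C1_domain_def)
  obtain U g Dg where xU: "x \<in> U" and loc: "C1_local_defining \<Omega> U g Dg"
    using \<Omega> x unfolding C1_domain_def by blast
  have U: "open U" "GDERIV g x :> Dg x" "Dg x \<noteq> 0" "\<Omega> \<inter> U = {y\<in>U. g y < 0}"
    using loc xU by (auto simp: C1_local_defining_def)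
  have g0: "g x = 0" by (rule C1_local_defining_zero[OF loc op x xU])
  define D where "D = Dg x"
  have D: "D \<bullet> D > 0" using U by (simp add: D_def)
  \<comment> \<open>Every direction \<open>v\<close> entering the ball decreases \<open>g\<close> weakly to first order. Applied to
    \<open>y - x + D\<close>, this gives the strict inequality below.\<close>
  have nonpos: "v \<bullet> D \<le> 0" if v: "v \<bullet> (y - x) > 0" for v
  proof (rule ccontr)
    assume "\<not> v \<bullet> D \<le> 0"
    then have "v \<bullet> D > 0" by simp
    then obtain d where d: "d > 0" "\<And>t. 0 < t \<Longrightarrow> t < d \<Longrightarrow> g x < g (x + t *\<^sub>R v)"
      using DERIV_pos_inc_right[OF gderiv_along_line[of g x 0 v D]] U by (auto simp: D_def)
    have v0: "v \<noteq> 0" using v by auto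
    obtain e where e: "e > 0" "ball x e \<subseteq> U" using U xU open_contains_ball by blast
    have "0 < min d (min (e / norm v) (2 * (v \<bullet> (y - x)) / (norm v)\<^sup>2))"
      using d e v v0 by simp
    then obtain t where "0 < t" "t < min d (min (e / norm v) (2 * (v \<bullet> (y - x)) / (norm v)\<^sup>2))"
      using dense by blast
    then have t: "0 < t" "t < d" "t * norm v < e" "t * (norm v)\<^sup>2 < 2 * (v \<bullet> (y - x))"
      using v0 by (simp_all add: field_simps)
    have "x + t *\<^sub>R v \<in> ball x e" using t by (simp add: dist_norm)
    then have 1: "x + t *\<^sub>R v \<in> U" using e by blast
    have "(norm (x + t *\<^sub>R v - y))\<^sup>2 = R\<^sup>2 + t * (t * (norm v)\<^sup>2 - 2 * (v \<bullet> (y - x)))"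
      using R(2) unfolding dist_norm
      by (auto simp: power2_norm_eq_inner algebra_simps inner_commute)
    also have "\<dots> < R\<^sup>2" using t by (simp add: mult_pos_neg)
    finally have "norm (x + t *\<^sub>R v - y) < R" using R(1) by (simp add: power_less_imp_less_base)
    then have "x + t *\<^sub>R v \<in> \<Omega>" using B by (auto simp: dist_norm norm_minus_commute)
    with 1 U(4) have "g (x + t *\<^sub>R v) < 0" by blast
    with d(2) t g0 show False by force
  qed
  have "(x - y) \<bullet> D > 0"
  proof (rule ccontr)
    assume "\<not> (x - y) \<bullet> D > 0"
    then have yD: "(y - x) \<bullet> D \<ge> 0" by (simp add: inner_diff_left)
    have "(y - x) \<bullet> (y - x) > 0" using R by auto
    moreover have "D \<bullet> (y - x) \<ge> 0" using yD by (simp add: inner_commute)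
    ultimately have "(y - x + D) \<bullet> (y - x) > 0" unfolding inner_add_left by (rule add_pos_nonneg)
    then have "(y - x + D) \<bullet> D \<le> 0" by (rule nonpos)
    with yD D show False unfolding inner_add_left by linarith
  qed
  then show ?thesis using U(3) by (simp add: exterior_normal_eq[OF op x xU loc] D_def)
qed

section \<open>The strong maximum principle\<close>

lemma subsolution_positive_max_constant:
  fixes F :: "real^'n \<Rightarrow> real^'n \<Rightarrow> real^'n^'n \<Rightarrow> real"
  assumes hyps: "homogeneity_condition \<Omega> \<alpha> F" "ellipticity_condition \<Omega> \<alpha> F"
      "bounded (b ` closure \<Omega>)" "\<forall>x\<in>closure \<Omega>. c x \<le> 0"
      "viscosity_subsolution \<Omega> \<alpha> F b c f u" "bounded \<Omega>"
    and \<Omega>: "C1_domain \<Omega>" "interior_sphere_condition \<Omega>"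
    and f: "\<forall>x\<in>frontier \<Omega>. f x m \<ge> 0"
    and m: "m > 0" "\<forall>x\<in>closure \<Omega>. u x \<le> m" "\<exists>x\<in>closure \<Omega>. u x = m"
  shows "\<forall>x\<in>closure \<Omega>. u x = m"
proof -
  have op: "open \<Omega>" and conn: "connected \<Omega>" using \<Omega>(1) by (auto simp: C1_domain_def)
  have sub: "viscosity_subsolution \<Omega> \<alpha> F b c f u" and usc: "usc_on (closure \<Omega>) u"
    using hyps(5) unfolding viscosity_subsolution_def by blast+
  note hopf = hopf_test_function[OF hyps _ _ m(1,2)]
  have near: "\<exists>V. open V \<and> x \<in> V \<and> (\<forall>z\<in>V \<inter> closure \<Omega>. u z < m)"
    if x: "x \<in> closure \<Omega>" "u x < m" for x
  proof -
    have "\<forall>\<^sub>F z in at x within closure \<Omega>. u z < m" using usc x unfolding usc_on_def by blast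
    then obtain V where "open V" "x \<in> V" "\<forall>z\<in>V. z \<noteq> x \<longrightarrow> z \<in> closure \<Omega> \<longrightarrow> u z < m"
      unfolding eventually_at_topological by blast
    then show ?thesis using x by (intro exI[of _ V]) auto
  qed
  have interior: "\<exists>x\<in>\<Omega>. u x = m"
  proof (rule ccontr)
    assume no: "\<not> (\<exists>x\<in>\<Omega>. u x = m)"
    then have lt: "\<forall>x\<in>\<Omega>. u x < m" using m(2) closure_subset by (metis order_less_le subsetD)
    obtain x where x: "x \<in> closure \<Omega>" "u x = m" using m(3) by blast
    then have xf: "x \<in> frontier \<Omega>" using no op by (auto simp: frontier_def interior_open)
    then obtain R y where R: "R > 0" "dist x y = R" "ball y R \<subseteq> \<Omega>"
      using \<Omega>(2) unfolding interior_sphere_condition_def by blast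
    have "\<forall>x\<in>ball y R. u x < m" using lt R(3) by blast
    then obtain \<phi> D\<phi> H\<phi> s where t: "C2_closure \<Omega> \<phi> D\<phi> H\<phi>" "local_max_at (closure \<Omega>) (\<lambda>x. u x - \<phi> x) x"
      "s > 0" "D\<phi> x = s *\<^sub>R (x - y)" "G_op \<alpha> F b c x m (D\<phi> x) (H\<phi> x) < 0"
      by (rule hopf[OF R(1,3) _ x(1) R(2) x(2)])
    have "D\<phi> x \<noteq> 0" using t(3,4) R by auto
    then have "min (- G_op \<alpha> F b c x (u x) (D\<phi> x) (H\<phi> x)) (B_op \<Omega> f x (u x) (D\<phi> x)) \<le> 0"
      using sub xf t(1,2) unfolding viscosity_subsolution_def by blast
    then have "f x m + D\<phi> x \<bullet> exterior_normal \<Omega> x \<le> 0"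
      using t(5) x(2) by (auto simp: B_op_def min_le_iff_disj)
    moreover have "D\<phi> x \<bullet> exterior_normal \<Omega> x > 0"
      using exterior_normal_of_interior_ball[OF \<Omega>(1) xf R] t(3,4) by simp
    ultimately show False using f xf by force
  qed
  have all: "u x = m" if x: "x \<in> \<Omega>" for x
  proof (rule ccontr)
    assume "u x \<noteq> m"
    define Z where "Z = {x\<in>closure \<Omega>. u x = m}"
    have "closed Z"
    proof -
      have "open (- Z)"
      proof (subst open_subopen, intro ballI)
        fix z assume z: "z \<in> - Z"
        show "\<exists>T. open T \<and> z \<in> T \<and> T \<subseteq> - Z"
        proof (cases "z \<in> closure \<Omega>")
          case True
          then have "u z < m" using z m(2) by (auto simp: Z_def order_less_le)
          with near[OF True] show ?thesis by (force simp: Z_def)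
        next
          case False
          then show ?thesis by (intro exI[of _ "- closure \<Omega>"]) (auto simp: Z_def)
        qed
      qed
      then show ?thesis by (simp add: closed_def)
    qed
    \<comment> \<open>\<open>\<Omega>\<close> being connected, the set where \<open>u = m\<close> has a point \<open>p\<close> of \<open>\<Omega>\<close> on its boundary; near \<open>p\<close>
      there is a ball in \<open>\<Omega>\<close> on which \<open>u < m\<close>, with \<open>u = m\<close> somewhere on its sphere.\<close>
    have "\<not> open (\<Omega> \<inter> Z)"
    proof
      assume "open (\<Omega> \<inter> Z)"
      moreover have "open (\<Omega> - Z)" using op \<open>closed Z\<close> by auto
      moreover have "\<Omega> \<inter> Z \<noteq> {}" using interior closure_subset by (auto simp: Z_def)
      moreover have "\<Omega> - Z \<noteq> {}" using x \<open>u x \<noteq> m\<close> by (auto simp: Z_def)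
      ultimately show False using connectedD[OF conn, of "\<Omega> \<inter> Z" "\<Omega> - Z"] by auto
    qed
    then obtain p where p: "p \<in> \<Omega>" "p \<in> Z" "\<And>e. e > 0 \<Longrightarrow> \<not> ball p e \<subseteq> \<Omega> \<inter> Z"
      unfolding open_contains_ball by blast
    obtain e where e: "e > 0" "ball p e \<subseteq> \<Omega>" using op p(1) open_contains_ball by blast
    have "\<not> ball p (e / 2) \<subseteq> \<Omega> \<inter> Z" using p(3) e by simp
    then obtain y where "y \<in> ball p (e / 2)" "y \<notin> \<Omega> \<inter> Z" by blast
    moreover have "ball p (e / 2) \<subseteq> ball p e" using e by auto
    ultimately have y: "dist p y < e / 2" "y \<in> \<Omega>" "y \<notin> Z" using e(2) by auto
    obtain x0 where x0: "x0 \<in> Z" "\<And>z. z \<in> Z \<Longrightarrow> dist y x0 \<le> dist y z"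
      using distance_attains_inf[OF \<open>closed Z\<close>, of y] p(2) by blast
    define R where "R = dist x0 y"
    have R: "R > 0" using x0(1) y(3) by (auto simp: R_def)
    have "R \<le> dist p y" using x0(2)[OF p(2)] by (simp add: R_def dist_commute)
    then have Re: "R < e / 2" using y(1) by simp
    have dp: "dist p z < e" if "dist y z \<le> R" for z
      using dist_triangle[of p z y] that y(1) Re by simp
    have B: "ball y R \<subseteq> \<Omega>" using e(2) dp by (metis less_imp_le mem_ball subset_eq)
    have lt: "\<forall>z\<in>ball y R. u z < m"
    proof
      fix z assume z: "z \<in> ball y R"
      then have "z \<in> closure \<Omega>" using B closure_subset by blast
      moreover have "z \<notin> Z" using x0(2)[of z] z by (auto simp: R_def dist_commute)
      ultimately show "u z < m" using m(2) by (auto simp: Z_def order_less_le)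
    qed
    have x0\<Omega>: "x0 \<in> \<Omega>" using dp[of x0] e(2) by (auto simp: R_def dist_commute)
    have x0c: "x0 \<in> closure \<Omega>" "u x0 = m" using x0(1) by (auto simp: Z_def)
    obtain \<phi> D\<phi> H\<phi> s where t: "C2_closure \<Omega> \<phi> D\<phi> H\<phi>"
      "local_max_at (closure \<Omega>) (\<lambda>x. u x - \<phi> x) x0"
      "s > 0" "D\<phi> x0 = s *\<^sub>R (x0 - y)" "G_op \<alpha> F b c x0 m (D\<phi> x0) (H\<phi> x0) < 0"
      by (rule hopf[OF R B lt x0c(1) R_def[symmetric] x0c(2)])
    have "D\<phi> x0 \<noteq> 0" using t(3,4) R by (auto simp: R_def)
    moreover have "local_max_at \<Omega> (\<lambda>x. u x - \<phi> x) x0"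
      using t(2) x0\<Omega> closure_subset[of \<Omega>] unfolding local_max_at_def by blast
    ultimately have "G_op \<alpha> F b c x0 (u x0) (D\<phi> x0) (H\<phi> x0) \<ge> 0"
      using sub x0\<Omega> t(1) unfolding viscosity_subsolution_def by blast
    then show False using t(5) x0c(2) by simp
  qed
  \<comment> \<open>By upper semicontinuity the value \<open>m\<close> passes to the boundary.\<close>
  show ?thesis
  proof (rule ballI, rule ccontr)
    fix x assume x: "x \<in> closure \<Omega>" and "u x \<noteq> m"
    then have "u x < m" using m(2) by (simp add: order_less_le)
    with near[OF x] obtain V where V: "open V" "x \<in> V" "\<forall>z\<in>V \<inter> closure \<Omega>. u z < m" by blast
    then obtain z where "z \<in> V" "z \<in> \<Omega>" using x open_Int_closure_eq_empty[OF V(1), of \<Omega>] by blast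
    moreover have "z \<in> closure \<Omega>" using \<open>z \<in> \<Omega>\<close> closure_subset by blast
    ultimately show False using V(3) all[of z] by auto
  qed
qed

section \<open>A boundary point with nonpositive second fundamental form\<close>

text \<open>
  The representation of the boundary as a graph speaks of boundary points only. That the domain lies
  below the graph follows from the defining function \<open>g\<close>, which increases strictly along the
  normal direction near \<open>x\<close>.
\<close>

lemma closure_below_paraboloid:
  fixes x :: "real^'n"
  assumes \<Omega>: "C1_domain \<Omega>" and x: "x \<in> frontier \<Omega>"
    and S: "second_fundamental_form \<Omega> x S" "loewner_le S 0" and e: "e > 0"
  shows "\<exists>V. open V \<and> x \<in> V \<and>
    (\<forall>z\<in>V \<inter> closure \<Omega>. (z - x) \<bullet> exterior_normal \<Omega> x \<le> e * (norm (z - x))\<^sup>2)"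
proof -
  have op: "open \<Omega>" using \<Omega> by (simp add: C1_domain_def)
  obtain U g Dg where xU: "x \<in> U" and loc: "C1_local_defining \<Omega> U g Dg"
    using \<Omega> x unfolding C1_domain_def by blast
  have U: "open U" "\<And>y. y \<in> U \<Longrightarrow> GDERIV g y :> Dg y" "Dg x \<noteq> 0"
      "\<Omega> \<inter> U = {y\<in>U. g y < 0}" "continuous_on U Dg"
    using loc xU by (auto simp: C1_local_defining_def)
  define n where "n = exterior_normal \<Omega> x"
  have n: "n = Dg x /\<^sub>R norm (Dg x)" unfolding n_def by (rule exterior_normal_eq[OF op x xU loc])
  have n1: "n \<bullet> n = 1" "norm n = 1" using U(3) by (simp_all add: n dot_square_norm power2_eq_square)
  have zero: "g z = 0" if "z \<in> frontier \<Omega>" "z \<in> U" for z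
    using C1_local_defining_zero[OF loc op that] .
  have nonpos: "g z \<le> 0" if "z \<in> closure \<Omega>" "z \<in> U" for z
  proof (cases "z \<in> \<Omega>")
    case True
    then show ?thesis using that U(4) by force
  next
    case False
    then have "z \<in> frontier \<Omega>" using that op by (simp add: frontier_def interior_open)
    then show ?thesis using zero that by simp
  qed
  define T where "T = {\<xi>. \<xi> \<bullet> n = 0}"
  obtain U' \<rho> where U': "open U'" "x \<in> U'" and \<rho>: "((\<lambda>\<xi>. \<rho> \<xi> / (norm \<xi>)\<^sup>2) \<longlongrightarrow> 0) (at 0 within T)"
    and fr: "frontier \<Omega> \<inter> U' = (\<lambda>\<xi>. x + \<xi> + ((\<xi> \<bullet> (S *v \<xi>)) / 2 + \<rho> \<xi>) *\<^sub>R n) ` T \<inter> U'"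
    using S(1) unfolding second_fundamental_form_def Let_def T_def n_def by blast
  have "\<forall>\<^sub>F \<xi> in at 0 within T. dist (\<rho> \<xi> / (norm \<xi>)\<^sup>2) 0 < e" using \<rho> e by (rule tendstoD)
  then obtain d where d: "d > 0"
    "\<And>\<xi>. \<xi> \<in> T \<Longrightarrow> \<xi> \<noteq> 0 \<Longrightarrow> norm \<xi> < d \<Longrightarrow> \<bar>\<rho> \<xi>\<bar> / (norm \<xi>)\<^sup>2 < e"
    unfolding eventually_at by auto
  have "((\<lambda>y. n \<bullet> Dg y) \<longlongrightarrow> n \<bullet> Dg x) (at x)"
    using U xU by (intro tendsto_intros) (simp add: continuous_on_eq_continuous_at isCont_def)
  moreover have nD: "n \<bullet> Dg x > 0" using U(3) by (simp add: n)
  ultimately have "\<forall>\<^sub>F y in at x. n \<bullet> Dg y > 0" by (rule order_tendstoD(1))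
  then obtain W where W: "open W" "x \<in> W" "\<And>y. y \<in> W \<Longrightarrow> n \<bullet> Dg y > 0"
    unfolding eventually_at_topological using nD that by (metis UNIV_I)
  obtain r where r: "r > 0" "ball x r \<subseteq> U \<inter> U' \<inter> W"
    using openE[of "U \<inter> U' \<inter> W" x] U(1) U'(1,2) W(1,2) xU by blast
  have inc: "g p < g (p + s *\<^sub>R n)"
    if p: "p \<in> ball x r" "p + s *\<^sub>R n \<in> ball x r" and s: "s > 0" for p s
  proof -
    have in_ball: "p + t *\<^sub>R n \<in> ball x r" if "0 \<le> t" "t \<le> s" for t
    proof -
      have "p + t *\<^sub>R n = (1 - t / s) *\<^sub>R p + (t / s) *\<^sub>R (p + s *\<^sub>R n)"
        using s by (simp add: algebra_simps)
      also have "\<dots> \<in> ball x r" using p s that by (intro convexD[OF convex_ball]) auto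
      finally show ?thesis .
    qed
    have "g (p + 0 *\<^sub>R n) < g (p + s *\<^sub>R n)"
    proof (rule DERIV_pos_imp_increasing[OF s])
      fix t assume "0 \<le> t" "t \<le> s"
      then have "p + t *\<^sub>R n \<in> U" "p + t *\<^sub>R n \<in> W" using in_ball r(2) by blast+
      then show "\<exists>y. ((\<lambda>t. g (p + t *\<^sub>R n)) has_real_derivative y) (at t) \<and> 0 < y"
        using gderiv_along_line U(2) W(3) by blast
    qed
    then show ?thesis by simp
  qed
  \<comment> \<open>The height of the graph over a small tangent vector \<open>\<xi>\<close> is at most \<open>C * |\<xi>|^2\<close> in absolute
    value; \<open>r'\<close> is chosen such that for \<open>|\<xi>| < r'\<close> the graph point stays in \<open>ball x r\<close>.\<close>
  define C where "C = onorm ((*v) S) / 2 + e"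
  have C: "C > 0" using onorm_pos_le[OF matrix_vector_mul_bounded_linear[of S]] e by (simp add: C_def)
  define r' where "r' = min (min r d) (min 1 (r / (1 + C)))"
  have r': "r' > 0" "r' \<le> r" "r' \<le> d" "r' \<le> 1" "r' * (1 + C) \<le> r"
  proof -
    show "r' > 0" using r(1) d(1) C by (simp add: r'_def)
    show "r' \<le> r" "r' \<le> d" "r' \<le> 1" by (simp_all add: r'_def)
    have "r' \<le> r / (1 + C)" by (simp add: r'_def)
    then show "r' * (1 + C) \<le> r" using C by (simp add: pos_le_divide_eq)
  qed
  have "(z - x) \<bullet> n \<le> e * (norm (z - x))\<^sup>2" if z: "z \<in> ball x r'" "z \<in> closure \<Omega>" for z
  proof (rule ccontr)
    assume neg: "\<not> ?thesis"
    define y \<xi> where "y = (z - x) \<bullet> n" and "\<xi> = z - x - y *\<^sub>R n"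
    have \<xi>T: "\<xi> \<bullet> n = 0" using n1 by (simp add: \<xi>_def y_def inner_diff_left)
    have zr: "z \<in> ball x r" "z \<in> U" using z r'(2) r(2) by auto
    have y: "y > e * (norm (z - x))\<^sup>2" using neg by (simp add: y_def)
    have zx: "z - x = \<xi> + y *\<^sub>R n" by (simp add: \<xi>_def)
    have "(norm (z - x))\<^sup>2 = (norm \<xi>)\<^sup>2 + y\<^sup>2"
      unfolding zx power2_norm_eq_inner using \<xi>T n1
      by (simp add: inner_add_left inner_add_right inner_commute power2_eq_square)
    then have nxi2: "(norm \<xi>)\<^sup>2 \<le> (norm (z - x))\<^sup>2" by simp
    then have "norm \<xi> \<le> norm (z - x)" by (rule power2_le_imp_le) simp
    then have nxi: "norm \<xi> < r'" using z by (simp add: dist_norm norm_minus_commute)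
    \<comment> \<open>There is a boundary point straight below \<open>z\<close>. For \<open>\<xi> = 0\<close> it is \<open>x\<close> itself: the limit
      at \<open>0\<close> says nothing about \<open>\<rho> 0\<close>.\<close>
    have "\<exists>h. h < y \<and> x + \<xi> + h *\<^sub>R n \<in> frontier \<Omega> \<inter> ball x r"
    proof (cases "\<xi> = 0")
      case True
      have "y > 0" using y e by (smt (verit) mult_nonneg_nonneg zero_le_power2)
      then show ?thesis using x r True by (intro exI[of _ 0]) auto
    next
      case False
      define h where "h = \<xi> \<bullet> (S *v \<xi>) / 2 + \<rho> \<xi>"
      have \<rho>b: "\<bar>\<rho> \<xi>\<bar> \<le> e * (norm \<xi>)\<^sup>2"
        using d(2)[of \<xi>] \<xi>T False nxi r' by (simp add: T_def field_simps)
      have "\<xi> \<bullet> (S *v \<xi>) \<le> 0" using S(2) by (simp add: loewner_le_def)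
      then have "h \<le> e * (norm \<xi>)\<^sup>2" using \<rho>b by (simp add: h_def)
      also have "\<dots> \<le> e * (norm (z - x))\<^sup>2" using nxi2 e by simp
      finally have hy: "h < y" using y by simp
      have "\<bar>\<xi> \<bullet> (S *v \<xi>)\<bar> \<le> norm \<xi> * norm (S *v \<xi>)" by (rule Cauchy_Schwarz_ineq2)
      also have "\<dots> \<le> norm \<xi> * (onorm ((*v) S) * norm \<xi>)"
        by (intro mult_left_mono onorm matrix_vector_mul_bounded_linear) auto
      finally have "\<bar>h\<bar> \<le> C * (norm \<xi>)\<^sup>2"
        using \<rho>b by (simp add: h_def C_def power2_eq_square algebra_simps abs_if split: if_splits)
      also have "\<dots> \<le> C * norm \<xi>"
        using C nxi r'(4) by (simp add: power2_eq_square mult_left_le_one_le)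
      finally have "\<bar>h\<bar> \<le> C * norm \<xi>" .
      then have "norm (\<xi> + h *\<^sub>R n) \<le> (1 + C) * norm \<xi>"
        using norm_triangle_ineq[of \<xi> "h *\<^sub>R n"] n1 by (simp add: algebra_simps)
      also have "\<dots> < (1 + C) * r'" using nxi C by simp
      also have "\<dots> \<le> r" using r' by (simp add: mult.commute)
      finally have P: "x + \<xi> + h *\<^sub>R n \<in> ball x r"
        using norm_minus_cancel[of "\<xi> + h *\<^sub>R n"] by (simp add: dist_norm)
      moreover have "x + \<xi> + h *\<^sub>R n \<in> frontier \<Omega> \<inter> U'"
        unfolding fr h_def using \<xi>T P r(2) by (auto simp: T_def h_def)
      ultimately show ?thesis using hy by blast
    qed
    then obtain h where h: "h < y" "x + \<xi> + h *\<^sub>R n \<in> frontier \<Omega>" "x + \<xi> + h *\<^sub>R n \<in> ball x r"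
      by blast
    have "z = x + \<xi> + h *\<^sub>R n + (y - h) *\<^sub>R n" by (simp add: \<xi>_def algebra_simps)
    then have "g (x + \<xi> + h *\<^sub>R n) < g z" using inc[of "x + \<xi> + h *\<^sub>R n" "y - h"] h zr by simp
    moreover have "g (x + \<xi> + h *\<^sub>R n) = 0" using zero h r(2) by blast
    ultimately show False using nonpos[OF z(2) zr(2)] by simp
  qed
  then show ?thesis using r'(1) unfolding n_def[symmetric]
    by (intro exI[of _ "ball x r'"]) auto
qed

text \<open>
  The constant \<open>m\<close> is tested at \<open>x\<close> with a function whose gradient is \<open>- t *\<^sub>R n\<close>, which
  turns the drift \<open>b x\<close> into a negative term.
\<close>

lemma no_positive_constant_subsolution:
  fixes F :: "real^'n \<Rightarrow> real^'n \<Rightarrow> real^'n^'n \<Rightarrow> real"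
  assumes hyps: "homogeneity_condition \<Omega> \<alpha> F" "ellipticity_condition \<Omega> \<alpha> F"
    and sub: "viscosity_subsolution \<Omega> \<alpha> F b c f u"
    and \<Omega>: "C1_domain \<Omega>" and x: "x \<in> frontier \<Omega>"
    and S: "second_fundamental_form \<Omega> x S" "loewner_le S 0"
    and b: "b x \<bullet> exterior_normal \<Omega> x > 0" and c: "c x = 0" and f: "f x m > 0"
    and const: "\<forall>z\<in>closure \<Omega>. u z = m"
  shows False
proof -
  have op: "open \<Omega>" using \<Omega> by (simp add: C1_domain_def)
  have xc: "x \<in> closure \<Omega>" using x by (simp add: frontier_def)
  define n where "n = exterior_normal \<Omega> x"
  have n1: "norm n = 1" unfolding n_def by (rule norm_exterior_normal[OF \<Omega> x])
  obtain a A :: real where aA: "a > 0" "A > 0" and ell: "\<And>x p s N. x \<in> closure \<Omega> \<Longrightarrow> p \<noteq> 0 \<Longrightarrow> s \<ge> 0 \<Longrightarrow>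
       transpose N = N \<Longrightarrow> loewner_le 0 N \<Longrightarrow>
       F x p (s *\<^sub>R (mat 1 - N)) \<le> s * (norm p powr \<alpha> * (A * CARD('n) - a * trace N))"
    using elliptic_upper_bound[OF hyps] by metis
  have "b x \<bullet> n > 0" using b by (simp add: n_def)
  define e where "e = (b x \<bullet> n) / (4 * A * CARD('n))"
  have e: "e > 0" using \<open>b x \<bullet> n > 0\<close> aA by (simp add: e_def)
  have eb: "2 * e * (A * CARD('n)) < b x \<bullet> n" using \<open>b x \<bullet> n > 0\<close> aA by (simp add: e_def)
  define t where "t = f x m / 2"
  have t: "t > 0" "t < f x m" using f by (simp_all add: t_def)
  define \<phi> where "\<phi> z = t * (e * ((z - x) \<bullet> (z - x)) - (z - x) \<bullet> n)" for z
  define D\<phi> where "D\<phi> z = t *\<^sub>R ((2 * e) *\<^sub>R (z - x) - n)" for z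
  define H\<phi> :: "real^'n \<Rightarrow> real^'n^'n" where "H\<phi> z = (2 * t * e) *\<^sub>R (mat 1 - 0)" for z
  have "GDERIV \<phi> z :> D\<phi> z" for z
    unfolding gderiv_def \<phi>_def[abs_def] D\<phi>_def
    by (rule has_derivative_eq_rhs, (rule derivative_intros)+)
      (simp add: inner_commute fun_eq_iff inner_diff_right)
  moreover have "(D\<phi> has_derivative (\<lambda>h. H\<phi> z *v h)) (at z)" for z
    unfolding H\<phi>_def D\<phi>_def[abs_def]
    by (rule has_derivative_eq_rhs, (rule derivative_intros)+)
      (simp add: fun_eq_iff scaleR_matrix_vector_assoc[symmetric])
  moreover have "continuous_on (closure \<Omega>) \<phi>" "continuous_on (closure \<Omega>) D\<phi>"
      "continuous_on (closure \<Omega>) H\<phi>"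
    unfolding \<phi>_def[abs_def] D\<phi>_def[abs_def] H\<phi>_def[abs_def] by (intro continuous_intros)+
  ultimately have C2: "C2_closure \<Omega> \<phi> D\<phi> H\<phi>" unfolding C2_closure_def by blast
  obtain V where V: "open V" "x \<in> V"
      "\<And>z. z \<in> V \<inter> closure \<Omega> \<Longrightarrow> (z - x) \<bullet> n \<le> e * (norm (z - x))\<^sup>2"
    using closure_below_paraboloid[OF \<Omega> x S e] unfolding n_def by blast
  have "\<phi> z \<ge> 0" if "z \<in> V \<inter> closure \<Omega>" for z
    using V(3)[OF that] t by (simp add: \<phi>_def dot_square_norm)
  moreover have "\<phi> x = 0" by (simp add: \<phi>_def)
  ultimately have "local_max_at (closure \<Omega>) (\<lambda>z. u z - \<phi> z) x"
    unfolding local_max_at_def using V xc const by (intro conjI exI[of _ V]) auto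
  moreover have Dx: "D\<phi> x = - t *\<^sub>R n" by (simp add: D\<phi>_def)
  moreover have "D\<phi> x \<noteq> 0" using Dx t n1 by auto
  moreover have ux: "u x = m" using const xc by simp
  ultimately have "min (- G_op \<alpha> F b c x m (D\<phi> x) (H\<phi> x)) (B_op \<Omega> f x m (D\<phi> x)) \<le> 0"
    using sub x C2 unfolding viscosity_subsolution_def by blast
  moreover have "B_op \<Omega> f x m (D\<phi> x) = f x m - t"
    using n1 by (simp add: B_op_def Dx n_def[symmetric] dot_square_norm)
  ultimately have "G_op \<alpha> F b c x m (D\<phi> x) (H\<phi> x) \<ge> 0" using t by (auto simp: min_le_iff_disj)
  moreover have "F x (D\<phi> x) (H\<phi> x) \<le> 2 * t * e * (t powr \<alpha> * (A * CARD('n)))"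
  proof -
    have "transpose (0 :: real^'n^'n) = 0" by (simp add: transpose_def vec_eq_iff)
    moreover have "norm (D\<phi> x) = t" using Dx n1 t by simp
    ultimately show ?thesis
      using ell[of x "D\<phi> x" "2 * t * e" 0] xc \<open>D\<phi> x \<noteq> 0\<close> t(1) e
      by (simp add: H\<phi>_def loewner_le_def trace_def)
  qed
  moreover have "b x \<bullet> D\<phi> x * norm (D\<phi> x) powr \<alpha> = - (t * (b x \<bullet> n) * t powr \<alpha>)"
    using t n1 by (simp add: Dx)
  ultimately have "0 \<le> t * t powr \<alpha> * (2 * e * (A * CARD('n)) - b x \<bullet> n)"
    using c by (simp add: G_op_def algebra_simps)
  moreover have "t * t powr \<alpha> > 0" using t by simp
  ultimately show False using eb by (simp add: zero_le_mult_iff)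
qed

theorem theorem4p5:
  fixes \<Omega> :: "(real^'n) set" and \<alpha> :: real
    and F :: "real^'n \<Rightarrow> real^'n \<Rightarrow> real^'n^'n \<Rightarrow> real"
    and b :: "real^'n \<Rightarrow> real^'n" and c :: "real^'n \<Rightarrow> real"
    and f :: "real^'n \<Rightarrow> real \<Rightarrow> real" and u :: "real^'n \<Rightarrow> real"
  assumes "\<alpha> > -1"
    and "bounded \<Omega>" and "C1_domain \<Omega>" and "interior_sphere_condition \<Omega>"
    and "homogeneity_condition \<Omega> \<alpha> F" and "ellipticity_condition \<Omega> \<alpha> F"
    and "holder_condition \<Omega> \<alpha> F"
    and "bounded (b ` closure \<Omega>)" and "continuous_on (closure \<Omega>) b"
    and "bounded (c ` closure \<Omega>)" and "continuous_on (closure \<Omega>) c"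
    and "\<forall>x\<in>frontier \<Omega>. f x 0 \<ge> 0" and "\<forall>x\<in>frontier \<Omega>. mono (f x)"
    and "\<forall>x\<in>closure \<Omega>. c x \<le> 0"
    and "viscosity_subsolution \<Omega> \<alpha> F b c f u"
  shows "((\<exists>x\<in>closure \<Omega>. c x \<noteq> 0) \<longrightarrow> (\<forall>x\<in>closure \<Omega>. u x \<le> 0)) \<and>
    ((\<forall>x\<in>closure \<Omega>. c x = 0) \<and> C2_domain \<Omega> \<and>
       (\<exists>xb\<in>frontier \<Omega>. b xb \<bullet> exterior_normal \<Omega> xb > 0 \<and> (\<forall>r>0. f xb r > 0) \<and>
          (\<exists>S. second_fundamental_form \<Omega> xb S \<and> loewner_le S 0))
       \<longrightarrow> (\<forall>x\<in>closure \<Omega>. u x \<le> 0)) \<and>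
    ((\<forall>x\<in>closure \<Omega>. c x = 0) \<and> (\<exists>xb\<in>frontier \<Omega>. \<forall>r>0. f xb r > 0) \<and>
       strong_subsolution \<Omega> \<alpha> F b c f u
       \<longrightarrow> (\<forall>x\<in>closure \<Omega>. u x \<le> 0))"
proof -
  have op: "open \<Omega>" using \<open>C1_domain \<Omega>\<close> by (simp add: C1_domain_def)
  have comp: "compact (closure \<Omega>)" using \<open>bounded \<Omega>\<close> by simp
  have sub: "viscosity_subsolution \<Omega> \<alpha> F b c f u" by fact
  have f_nonneg: "f x r \<ge> 0" if "x \<in> frontier \<Omega>" "r > 0" for x r
    using assms(12,13) that monoD[of "f x" 0 r] by force
  have const: "\<exists>m>0. \<forall>x\<in>closure \<Omega>. u x = m" if ex: "\<exists>x\<in>closure \<Omega>. u x > 0"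
  proof -
    have "usc_on (closure \<Omega>) u" using sub unfolding viscosity_subsolution_def by blast
    then obtain z where z: "z \<in> closure \<Omega>" "\<forall>x\<in>closure \<Omega>. u x \<le> u z"
      using usc_attains_max[OF comp, of u] ex by (metis empty_iff)
    then have "u z > 0" using ex by force
    have "\<forall>x\<in>closure \<Omega>. u x = u z"
    proof (rule subsolution_positive_max_constant)
      show "\<forall>x\<in>frontier \<Omega>. f x (u z) \<ge> 0" using f_nonneg \<open>u z > 0\<close> by blast
      show "\<exists>x\<in>closure \<Omega>. u x = u z" using z(1) by blast
    qed (fact assms z \<open>u z > 0\<close>)+
    with \<open>u z > 0\<close> show ?thesis by blast
  qed
  have part1: "\<forall>x\<in>closure \<Omega>. u x \<le> 0" if nz: "\<exists>x\<in>closure \<Omega>. c x \<noteq> 0"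
  proof (rule ccontr)
    assume "\<not> ?thesis"
    then obtain m where m: "m > 0" "\<forall>x\<in>closure \<Omega>. u x = m" using const by force
    have "c x = 0" if x: "x \<in> \<Omega>" for x
    proof -
      have "locally_const_at \<Omega> u x m"
        using op x m closure_subset[of \<Omega>] unfolding locally_const_at_def by blast
      then have "c x * (\<bar>m\<bar> powr \<alpha> * m) \<ge> 0"
        using sub x unfolding viscosity_subsolution_def by blast
      moreover have "\<bar>m\<bar> powr \<alpha> * m > 0" using m(1) by simp
      ultimately have "c x \<ge> 0" by (simp add: zero_le_mult_iff)
      moreover have "c x \<le> 0" using x closure_subset assms(14) by blast
      ultimately show ?thesis by simp
    qed
    then have "\<forall>x\<in>closure \<Omega>. c x = 0"
      using continuous_constant_on_closure[OF assms(11)] by blast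
    with nz show False by blast
  qed
  have part2: "\<forall>x\<in>closure \<Omega>. u x \<le> 0"
    if c: "\<forall>x\<in>closure \<Omega>. c x = 0" and xb: "xb \<in> frontier \<Omega>" "b xb \<bullet> exterior_normal \<Omega> xb > 0"
      "\<forall>r>0. f xb r > 0" and S: "second_fundamental_form \<Omega> xb S" "loewner_le S 0" for xb S
  proof (rule ccontr)
    assume "\<not> ?thesis"
    then obtain m where m: "m > 0" "\<forall>x\<in>closure \<Omega>. u x = m" using const by force
    have "c xb = 0" using c xb(1) by (simp add: frontier_def)
    then show False
      using no_positive_constant_subsolution[OF assms(5,6) sub assms(3) xb(1) S xb(2)] xb(3) m by blast
  qed
  have part3: "\<forall>x\<in>closure \<Omega>. u x \<le> 0"
    if xb: "xb \<in> frontier \<Omega>" "\<forall>r>0. f xb r > 0" and strong: "strong_subsolution \<Omega> \<alpha> F b c f u" for xb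
  proof (rule ccontr)
    assume "\<not> ?thesis"
    then obtain m where m: "m > 0" "\<forall>x\<in>closure \<Omega>. u x = m" using const by force
    have "locally_const_at (closure \<Omega>) u xb m"
      using xb m(2) unfolding locally_const_at_def by (auto simp: frontier_def)
    then have "B_op \<Omega> f xb m 0 \<le> 0" using strong xb(1) unfolding strong_subsolution_def by blast
    then show False using xb(2) m(1) by (force simp: B_op_def)
  qed
  show ?thesis using part1 part2 part3 by blast
qed

end
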